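(* For every integer $\ell\ge3$ let $\Delta(\ell)=\left\lfloor\log_2\binom{2^\ell}{\ell}\right\rfloor-k_\ell$. Then $\Delta(3)=0$, $\Delta(4)=1$, and for every $\ell\ge3$, $$\Delta(\ell)\ \le\ \left(1+\frac{1}{2\ln 2}\right)\ell-\frac32\log_2\ell-\frac{\ln(2\pi/e)}{2\ln 2}.$$
   Context: For an integer $\ell\ge 3$ define a finite integer sequence $f_\ell(1),\dots,f_\ell(\ell)$ as follows. If $\ell$ is not a power of $2$, put $\mu = 2^{\lceil \log_2 \ell\rceil} - \ell$ and $f_\ell(i) = \ell - \lceil \log_2\ell\rceil$ for $1\le i\le \ell-\mu$; $f_\ell(i) = \ell - \lfloor \log_2\ell\rfloor$ for $\ell-\mu+1\le i\le \ell-1$; $f_\ell(\ell)=\ell$. If $\ell$ is a power of $2$, put $f_\ell(1) = \ell-\log_2\ell-1$; $f_\ell(i)=\ell-\log_2\ell$ for $2\le i\le \ell-1$; $f_\ell(\ell)=\ell$. Define $k_\ell = \sum_{i=1}^{\ell} f_\ell(i)$. *)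

theory Defs
  imports Complex_Main
begin

text \<open>
  The integers \<open>2^\<lceil>log 2 l\<rceil> - l\<close> and \<open>f_seq l i\<close> are taken in \<^typ>\<open>int\<close>, so that no
  subtraction is truncated. Only \<open>l \<ge> 3\<close> and \<open>1 \<le> i \<le> l\<close> are meaningful.
\<close>

definition mu :: "nat \<Rightarrow> int" where
  "mu l = 2 ^ nat \<lceil>log 2 (real l)\<rceil> - int l"

text \<open>
  When \<open>l\<close> is a power of 2, \<open>log 2 l\<close> is an integer; the floor below only converts it from
  \<^typ>\<open>real\<close> to \<^typ>\<open>int\<close>.
\<close>

definition f_seq :: "nat \<Rightarrow> nat \<Rightarrow> int" where
  "f_seq l i =
    (if \<exists>m::nat. l = 2 ^ m then
       (if i = 1 then int l - \<lfloor>log 2 (real l)\<rfloor> - 1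
        else if i \<le> l - 1 then int l - \<lfloor>log 2 (real l)\<rfloor>
        else int l)
     else
       (if int i \<le> int l - mu l then int l - \<lceil>log 2 (real l)\<rceil>
        else if i \<le> l - 1 then int l - \<lfloor>log 2 (real l)\<rfloor>
        else int l))"

definition k_sum :: "nat \<Rightarrow> int" where
  "k_sum l = (\<Sum>i = 1..l. f_seq l i)"

definition Delta :: "nat \<Rightarrow> int" where
  "Delta l = \<lfloor>log 2 (real (2 ^ l choose l))\<rfloor> - k_sum l"

end

theory Submission
  imports Defs "HOL-Analysis.Harmonic_Numbers"
begin

text \<open>
  If \<open>2 ^ (c - 1) < l \<le> 2 ^ c\<close>, then \<open>k_l = l\<^sup>2 - l - 1 - c (l - 1) + 2 ^ c\<close>, whether or not \<open>l\<close> is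
  a power of 2. Together with \<open>binomial (2 ^ l) l \<le> 2 ^ l\<^sup>2 / l!\<close> and a Stirling-type bound for \<open>l!\<close>,
  and with \<open>c ln 2 = ln l + u\<close>, the claim becomes an inequality in \<open>u \<ge> 0\<close> that is linear in \<open>l\<close>.
  It has enough slack for \<open>e\<^sup>u \<ge> 1 + u + u\<^sup>2/2\<close> and for replacing \<open>ln (2 \<pi>) / 2\<close> by \<open>3/4\<close> in Stirling's
  formula; the latter bound has a short inductive proof.
\<close>

text \<open>In both cases the deficits \<open>l - f_seq l i\<close> add up to
  \<open>(l - 1) * Suc c + 1 - mu l\<close>. For a power of 2, where \<open>mu l = 0\<close>, the
  summand 1 is the extra decrement at \<open>i = 1\<close>.\<close>

lemma k_sum_eq:
  fixes l c :: nat
  assumes "l \<ge> 3" "2 ^ c < l" "l \<le> 2 ^ Suc c"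
  shows "k_sum l = int l ^ 2 - int l - 1 - int (Suc c) * (int l - 1) + 2 ^ Suc c"
proof (cases "l = 2 ^ Suc c")
  case True
  have log: "\<lfloor>log 2 (real l)\<rfloor> = int (Suc c)"
    unfolding True by (simp add: log_nat_power flip: power_Suc)
  have power: "\<exists>m. l = 2 ^ m"
    using True by blast
  have f1: "f_seq l 1 = int l - int (Suc c) - 1"
    by (simp add: f_seq_def log power)
  have fm: "f_seq l i = int l - int (Suc c)" if "i \<in> {1<..<l}" for i
    using that by (auto simp: f_seq_def log power)
  have fl: "f_seq l l = int l"
    using assms(1) by (auto simp: f_seq_def power)
  have "{1..l} = insert 1 (insert l {1<..<l})"
    using assms(1) by auto
  hence "k_sum l = f_seq l 1 + f_seq l l + (\<Sum>i\<in>{1<..<l}. f_seq l i)"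
    unfolding k_sum_def using assms(1) by simp
  also have "(\<Sum>i\<in>{1<..<l}. f_seq l i) = (int l - 2) * (int l - int (Suc c))"
    using assms(1) by (simp add: fm of_nat_diff)
  also have "2 ^ Suc c = int l"
    by (simp add: True)
  ultimately show ?thesis
    unfolding f1 fl by (simp add: algebra_simps power2_eq_square)
next
  case False
  hence less: "l < 2 ^ Suc c"
    using assms(3) by simp
  have not_power: "\<not> (\<exists>m. l = 2 ^ m)"
  proof
    assume "\<exists>m. l = 2 ^ m"
    then obtain m where m: "l = 2 ^ m" by blast
    from assms(2) less have "c < m" "m < Suc c"
      unfolding m by (simp_all only: power_strict_increasing_iff one_less_numeral_iff semiring_norm)
    thus False by simp
  qed
  have fl: "\<lfloor>log 2 (real l)\<rfloor> = int c"
    using floor_log_nat_eq_if[of 2 c l] assms(2) less by simp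
  have ce: "\<lceil>log 2 (real l)\<rceil> = int (Suc c)"
    using ceiling_log_nat_eq_if[of 2 c l] assms(2,3) by simp
  have mu: "mu l = 2 ^ Suc c - int l"
    by (simp add: mu_def ce nat_add_distrib)
  \<comment> \<open>The last index of the low block, as a natural number; \<open>2 ^ c < l\<close>
    prevents truncation.\<close>
  define m where "m = 2 * l - 2 ^ Suc c"
  have m_less: "m < l"
    using assms(1) less unfolding m_def by linarith
  have m: "int m = int l - mu l"
    using assms(2) by (simp add: m_def mu of_nat_diff)
  have low: "f_seq l i = int l - int (Suc c)" if "i \<in> {1..m}" for i
    using that not_power by (simp add: f_seq_def ce flip: m)
  have mid: "f_seq l i = int l - int c" if "i \<in> {m<..<l}" for i
    using that not_power by (auto simp: f_seq_def fl simp flip: m)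
  have top: "f_seq l l = int l"
    using m_less not_power by (simp add: f_seq_def flip: m)
  have "{1..l} = insert l ({1..m} \<union> {m<..<l})"
    using assms(1) m_less by auto
  hence "k_sum l = f_seq l l + (\<Sum>i\<in>{1..m} \<union> {m<..<l}. f_seq l i)"
    unfolding k_sum_def using m_less by simp
  also have "(\<Sum>i\<in>{1..m} \<union> {m<..<l}. f_seq l i) =
      (\<Sum>i\<in>{1..m}. f_seq l i) + (\<Sum>i\<in>{m<..<l}. f_seq l i)"
    by (rule sum.union_disjoint) auto
  also have "(\<Sum>i\<in>{1..m}. f_seq l i) = int m * (int l - int (Suc c))"
    by (simp add: low)
  also have "(\<Sum>i\<in>{m<..<l}. f_seq l i) = (int l - int m - 1) * (int l - int c)"
    using m_less by (simp add: mid of_nat_diff)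
  finally show ?thesis
    unfolding top m mu by (simp add: algebra_simps power2_eq_square)
qed

text \<open>
  The correction term \<open>1 / (4 n)\<close> makes the induction go through: by the trapezoid rule,
  \<open>(n + 1/2) ln (1 + 1/n) \<le> 1 + (1/n - 1/(n + 1)) / 4\<close>. At \<open>n = 1\<close> equality holds.
\<close>
lemma ln_fact_ge:
  fixes n :: nat
  assumes "n \<ge> 1"
  shows "ln (fact n) \<ge> (real n + 1/2) * ln (real n) - real n + 3/4 + 1 / (4 * real n)"
  using assms
proof (induction n rule: nat_induct_at_least)
  case base
  show ?case by simp
next
  case (Suc n)
  define x where "x = real n"
  have x: "x > 0"
    using Suc.hyps by (simp add: x_def)
  have "ln (x + 1) - ln x \<le> (1 / x + 1 / (x + 1)) / 2"
    using ln_inverse_approx_le[OF x zero_less_one] by (simp add: inverse_eq_divide)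
  hence "(x + 1/2) * (ln (x + 1) - ln x) \<le> (x + 1/2) * ((1 / x + 1 / (x + 1)) / 2)"
    using x by (intro mult_left_mono) auto
  also have "\<dots> = 1 + 1 / (4 * x) - 1 / (4 * (x + 1))"
    using x by (simp add: divide_simps) (simp add: algebra_simps)
  finally have step: "(x + 1/2) * (ln (x + 1) - ln x) \<le> 1 + 1 / (4 * x) - 1 / (4 * (x + 1))" .
  have "ln (fact (Suc n)) = ln (x + 1) + ln (fact n)"
    using x by (simp add: x_def ln_mult add.commute)
  with step Suc.IH show ?case
    by (simp add: x_def[symmetric] algebra_simps)
qed

text \<open>The product of the binomial coefficient and \<open>fact l\<close> is a falling factorial
  with \<open>l\<close> factors, each at most \<open>2 ^ l\<close>.\<close>

lemma log2_binomial_le: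
  fixes l :: nat
  shows "log 2 (real (2 ^ l choose l)) * ln 2 \<le> real l ^ 2 * ln 2 - ln (fact l)"
proof -
  have pos: "0 < real (2 ^ l choose l)"
    using less_exp[of l] by (simp add: zero_less_binomial_iff)
  have "real ((2 ^ l choose l) * fact l) \<le> real ((2 ^ l) ^ l)"
    using binomial_fact_pow[of "2 ^ l" l] by (rule of_nat_mono)
  hence "real (2 ^ l choose l) * fact l \<le> 2 ^ (l * l)"
    by (simp add: power_mult)
  hence "ln (real (2 ^ l choose l) * fact l) \<le> ln (2 ^ (l * l))"
    using pos by (subst ln_le_cancel_iff) auto
  hence "ln (real (2 ^ l choose l)) + ln (fact l) \<le> real l ^ 2 * ln 2"
    using pos by (simp add: ln_mult_pos ln_realpow power2_eq_square)
  thus ?thesis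
    by (simp add: log_def)
qed

text \<open>The value 13/6 is exactly what \<open>exp_slack\<close> tolerates:
  \<open>-1/3 + 13/12 = 3/4\<close>.\<close>

lemma ln_two_pi_le: "ln (2 * pi) \<le> 13 / 6"
proof -
  have "ln (2 * pi) \<le> ln (2 ^ 3)"
    using pi_less_4 pi_gt_zero by (subst ln_le_cancel_iff) auto
  also have "\<dots> = 3 * ln (2::real)"
    by (subst ln_realpow) auto
  finally show ?thesis
    using ln2_le_25_over_36 by simp
qed

text \<open>This is what remains of the main bound, multiplied by \<open>ln 2\<close>, once
  \<open>Suc c * ln 2 = ln l + u\<close> is substituted and the terms in \<open>ln l\<close> cancel.
  The 3/4 is the constant of \<open>ln_fact_ge\<close>.\<close>

lemma exp_slack:
  fixes l u :: real
  assumes "l \<ge> 3" "u \<ge> 0"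
  shows "ln 2 + (u + 1/2) * (l - 1) - l * (exp u * ln 2) + ln (2 * pi) / 2 \<le> 3/4"
proof -
  have taylor: "1 + u + u\<^sup>2 / 2 \<le> exp u"
    using assms(2) by (rule exp_lower_Taylor_quadratic)
  have "2/3 * (exp u - 1) \<le> ln 2 * (exp u - 1)"
    using assms(2) ln2_ge_two_thirds by (intro mult_right_mono) auto
  hence rest: "ln 2 * (exp u - 1) \<ge> 2/3 * (u + u\<^sup>2 / 2)"
    using taylor by argo
  have "2/3 * exp u \<le> ln 2 * exp u"
    using ln2_ge_two_thirds by (intro mult_right_mono) auto
  hence slope: "exp u * ln 2 - u - 1/2 \<ge> 1/6 - u/3 + u\<^sup>2/3"
    using taylor by argo
  \<comment> \<open>Completing the square shows that the coefficient of \<open>-(l - 1)\<close> is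
    positive, so \<open>l = 3\<close> is the worst case.\<close>
  have sq: "1/6 - u/3 + u\<^sup>2/3 = (u - 1/2)\<^sup>2 / 3 + 1/12"
    by (simp add: power2_eq_square field_simps)
  hence "exp u * ln 2 - u - 1/2 \<ge> 0"
    using slope zero_le_power2[of "u - 1/2"] by linarith
  hence "2 * (exp u * ln 2 - u - 1/2) \<le> (l - 1) * (exp u * ln 2 - u - 1/2)"
    using assms(1) by (intro mult_right_mono) auto
  with slope have "(l - 1) * (exp u * ln 2 - u - 1/2) \<ge> 1/3 - 2 * u/3 + 2 * u\<^sup>2/3"
    by argo
  moreover have "ln 2 + (u + 1/2) * (l - 1) - l * (exp u * ln 2) =
      - ((l - 1) * (exp u * ln 2 - u - 1/2)) - ln 2 * (exp u - 1)"
    by (simp add: algebra_simps)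
  \<comment> \<open>The terms linear in \<open>u\<close> from the two estimates cancel.\<close>
  ultimately have "ln 2 + (u + 1/2) * (l - 1) - l * (exp u * ln 2) \<le> - 1/3 - u\<^sup>2"
    using rest by (simp add: algebra_simps)
  moreover have "0 \<le> u\<^sup>2" by simp
  ultimately show ?thesis
    using ln_two_pi_le by linarith
qed

lemma Delta_le:
  fixes l :: nat
  assumes "l \<ge> 3"
  shows "real_of_int (Delta l) \<le> (1 + 1 / (2 * ln 2)) * real l - 3 / 2 * log 2 (real l)
          - ln (2 * pi / exp 1) / (2 * ln 2)"
proof -
  obtain c where c: "2 ^ c < l" "l \<le> 2 ^ Suc c"
    using ex_power_ivl2[of 2 l] assms by auto
  define x where "x = real l"
  define L :: real where "L = ln 2"
  have x: "x \<ge> 3" and L: "L > 0"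
    using assms by (simp_all add: x_def L_def)
  \<comment> \<open>\<open>exp u\<close> is the ratio of the power \<open>2 ^ Suc c\<close> to
    \<open>l\<close>.\<close>
  define u where "u = real (Suc c) * L - ln x"
  have pow: "(2::real) ^ Suc c = exp (real (Suc c) * L)"
    unfolding L_def exp_of_nat_mult by simp
  have "x \<le> 2 ^ Suc c"
    using of_nat_mono[OF c(2), where 'a = real] by (simp add: x_def)
  hence "ln x \<le> ln (exp (real (Suc c) * L))"
    unfolding pow using x by (subst ln_le_cancel_iff) auto
  hence u: "u \<ge> 0"
    by (simp add: u_def)
  have exp_u: "2 ^ Suc c = x * exp u"
    unfolding pow u_def using x by (simp add: exp_diff)
  have k_real: "real_of_int (k_sum l) = x\<^sup>2 - x - 1 - real (Suc c) * (x - 1) + 2 ^ Suc c"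
    unfolding k_sum_eq[OF assms c] x_def by simp
  have "real_of_int (k_sum l) * L =
      (x\<^sup>2 - x - 1) * L - (real (Suc c) * L) * (x - 1) + x * exp u * L"
    unfolding k_real exp_u by argo
  also have "real (Suc c) * L = ln x + u"
    by (simp add: u_def)
  finally have k: "real_of_int (k_sum l) * L =
      (x\<^sup>2 - x - 1) * L - (ln x + u) * (x - 1) + x * exp u * L" .
  have "real_of_int (Delta l) \<le> log 2 (real (2 ^ l choose l)) - real_of_int (k_sum l)"
    by (simp add: Delta_def)
  \<comment> \<open>Scaling by \<open>L = ln 2\<close> turns binary logarithms into natural ones;
    the factor is cancelled at the end.\<close>
  hence "real_of_int (Delta l) * L \<le> (log 2 (real (2 ^ l choose l)) - real_of_int (k_sum l)) * L"
    using L by (intro mult_right_mono) auto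
  also have "\<dots> \<le> x\<^sup>2 * L - ln (fact l) - real_of_int (k_sum l) * L"
    using log2_binomial_le[of l] by (simp add: L_def x_def algebra_simps)
  also have "\<dots> \<le> x\<^sup>2 * L - ((x + 1/2) * ln x - x + 3/4) - real_of_int (k_sum l) * L"
  proof -
    have "(x + 1/2) * ln x - x + 3/4 + 1 / (4 * x) \<le> ln (fact l)"
      using ln_fact_ge[of l] assms by (simp add: x_def)
    moreover have "1 / (4 * x) \<ge> 0" using x by simp
    ultimately show ?thesis by linarith
  qed
  also have "\<dots> \<le> (L + 1/2) * x - 3/2 * ln x - (ln (2 * pi) - 1) / 2"
    using exp_slack[OF x u] unfolding k L_def[symmetric] by argo
  also have "\<dots> = ((1 + 1 / (2 * ln 2)) * real l - 3 / 2 * log 2 (real l)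
          - ln (2 * pi / exp 1) / (2 * ln 2)) * L"
    using L by (simp add: log_def ln_div flip: x_def L_def) (simp add: field_simps)
  finally show ?thesis
    using L by simp
qed

lemma Delta_3: "Delta 3 = 0"
proof -
  have "(2 ^ 3 choose 3 :: nat) = 56"
    by (simp add: numeral_eq_Suc)
  moreover have "\<lfloor>log 2 (real 56)\<rfloor> = 5"
    using floor_log_nat_eq_if[of 2 5 56] by simp
  moreover have "k_sum 3 = 5"
    using k_sum_eq[of 3 1] by simp
  ultimately show ?thesis
    by (simp add: Delta_def)
qed

lemma Delta_4: "Delta 4 = 1"
proof -
  have "(2 ^ 4 choose 4 :: nat) = 1820"
    by (simp add: numeral_eq_Suc)
  moreover have "\<lfloor>log 2 (real 1820)\<rfloor> = 10"
    using floor_log_nat_eq_if[of 2 10 1820] by simp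
  \<comment> \<open>Again \<open>c = 1\<close>, since 4 is the included right end of the range
    \<open>2 < l \<le> 4\<close>.\<close>
  moreover have "k_sum 4 = 9"
    using k_sum_eq[of 4 1] by simp
  ultimately show ?thesis
    by (simp add: Delta_def)
qed

theorem mainTheorem8:
  shows "Delta 3 = 0 \<and> Delta 4 = 1 \<and>
    (\<forall>l::nat. l \<ge> 3 \<longrightarrow>
      real_of_int (Delta l) \<le>
        (1 + 1 / (2 * ln 2)) * real l - 3 / 2 * log 2 (real l)
          - ln (2 * pi / exp 1) / (2 * ln 2))"
  using Delta_3 Delta_4 Delta_le by blast

end
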